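(* Let $L_s=-\partial^2+u_s$ be an algebro-geometric Schrödinger operator with rational spectral curve $\Gamma_s$ parametrized by $(\chi_1(\tau),\chi_2(\tau))\in\mathbb{C}(\tau)^2$. Let $\partial-\tilde\phi_s$ be the intrinsic right factor of $L_s-\chi_1(\tau)$ in $K(\tau)[\partial]$. The Liouvillian extension $K(\tau)\langle\Upsilon_s\rangle$ of $K(\tau)$, by a nonzero solution $\Upsilon_s\in\widehat{K(\tau)}$ of $(\partial-\tilde\phi_s)\Upsilon=0$, is a transcendental extension with field of constants $\mathbb{C}(\tau)$.
   Context: $(\Sigma,\partial)$ is a differential field with field of constants $\mathbb{C}$. An operator $L\in\Sigma[\partial]\setminus\mathbb{C}[\partial]$ of order $n$ is algebro-geometric if some $P\in\Sigma[\partial]$ of order relatively prime to $n$ satisfies $[L,P]=0$. Let $L_s=-\partial^2+u_s$ with $u_s\in\Sigma\setminus\mathbb{C}$ be algebro-geometric. Then there is a unique monic operator $A_{2s+1}$ of minimal order $2s+1$ (minimal among operators of the centralizer not in $\mathbb{C}[L_s]$) such that the centralizer of $L_s$ in $\Sigma[\partial]$ is $\mathbb{C}[L_s,A_{2s+1}]$ and $A_{2s+1}^2+R_{2s+1}(L_s)=0$ with $R_{2s+1}\in\mathbb{C}[\lambda]$ of degree $2s+1$; $A_{2s+1}$ is the partner of $L_s$ and $s$ the level. $K=\mathbb{C}\langle u_s\rangle$ is the differential subfield of $\Sigma$ generated by $\mathbb{C}$ and $u_s$; $L_s,A_{2s+1}\in K[\partial]$. Let $\lambda,\mu$ be algebraic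 indeterminates over $K$ with $\partial\lambda=\partial\mu=0$. Put $f_s=\mu^2+R_{2s+1}(\lambda)$; the spectral curve $\Gamma_s\subset\mathbb{C}^2$ is $f_s=0$. $\mathbb{C}(\Gamma_s)$ and $K(\Gamma_s)$ are the fraction fields of the domains $\mathbb{C}[\lambda,\mu]/(f_s)$ and $K[\lambda,\mu]/(f_s)$; the derivation of $K(\Gamma_s)$ is induced by $\partial$ on $K[\lambda,\mu]$ acting on coefficients. The monic greatest common right divisor of $L_s-\lambda$ and $A_{2s+1}-\mu$ in $K(\Gamma_s)[\partial]$ has order one and is written $\partial-\phi_s$. $\Gamma_s$ is rational: its closure in $\mathbb{P}^2$ is birationally equivalent to $\mathbb{P}^1$, and the parametrization $(\chi_1,\chi_2)$ induces an isomorphism $\rho_1:\mathbb{C}(\Gamma_s)\to\mathbb{C}(\tau)$, $\lambda\mapsto\chi_1(\tau)$, $\mu\mapsto\chi_2(\tau)$. Here $\tau$ is an indeterminate over $K$ and $K(\tau)$ has the derivation extending $\partial$ with $\partial\tau=0$. $\rho_1$ extends to an isomorphism of differential fields $\rho_1:K(\Gamma_s)\to K(\tau)$ which is the identity on $K$. Put $\tilde\phi_s=\rho_1(\phi_s)$, so that $L_s-\chi_1(\tau)=(-\partial-\tilde\phi_s)(\partial-\tilde\phi_s)$ in $K(\tau)[\partial]$; $\partial-\tilde\phi_s$ is called the intrinsic right factor of $L_s-\chi_1(\tau)$. $\widehat{K(\tau)}$ is the differential closure of $K(\tau)$; $\langle\,\cdot\,\rangle$ denotes the generated differential field extension. *)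

theory Defs
  imports
    Complex_Main
    "HOL-Computational_Algebra.Computational_Algebra"
    "HOL-Computational_Algebra.Field_as_Ring"
    "HOL-Library.Poly_Mapping"
begin

section \<open>Differential rings and fields\<close>

class differential_ring = comm_ring_1 +
  fixes der :: "'a \<Rightarrow> 'a"
  assumes der_add: "der (x + y) = der x + der y"
    and der_mult: "der (x * y) = der x * y + x * der y"
begin

lemma der_0 [simp]: "der 0 = 0"
  using der_add[of 0 0] by simp

lemma der_1 [simp]: "der 1 = 0"
  using der_mult[of 1 1] by simp

lemma der_minus: "der (- x) = - der x"
proof -
  have "der x + der (- x) = 0"
    using der_add[of x "- x"] by simp
  then show ?thesis
    by (metis neg_eq_iff_add_eq_0)
qed

lemma der_diff: "der (x - y) = der x - der y"
  using der_add[of x "- y"] by (simp add: der_minus)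

end

class differential_field = differential_ring + field

text \<open>On \<open>R[x]\<close> the derivation acts on the coefficients, so the indeterminate is a constant
  (unlike \<^const>\<open>pderiv\<close>); iterating, this is also the derivation used on \<open>R[\<lambda>,\<mu>]\<close>.\<close>

instantiation poly :: (differential_ring) differential_ring
begin

definition der_poly :: "'a poly \<Rightarrow> 'a poly" where
  "der_poly p = map_poly der p"

lemma coeff_der_poly: "coeff (der p) n = der (coeff p n)" for p :: "'a poly"
  by (simp add: der_poly_def coeff_map_poly)

lemma der_sum: "der (sum f A) = (\<Sum>x\<in>A. der (f x))" for f :: "'b \<Rightarrow> 'a"
  by (induction A rule: infinite_finite_induct) (auto simp: der_add)

instance
proof
  fix x y :: "'a poly"
  show "der (x + y) = der x + der y"
    by (rule poly_eqI) (simp add: coeff_der_poly der_add)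
  show "der (x * y) = der x * y + x * der y"
    by (rule poly_eqI) (simp add: coeff_der_poly coeff_mult der_sum der_mult sum.distrib)
qed

end

instantiation fract :: ("{differential_ring, idom}") differential_field
begin

definition der_fract :: "'a fract \<Rightarrow> 'a fract" where
  "der_fract x = (THE y. \<exists>p q. q \<noteq> 0 \<and> x = Fract p q \<and> y = Fract (der p * q - p * der q) (q * q))"

lemma der_Fract:
  fixes p q :: 'a
  assumes q: "q \<noteq> 0"
  shows "der (Fract p q) = Fract (der p * q - p * der q) (q * q)"
proof -
  have unique: "Fract (der p' * q' - p' * der q') (q' * q') = Fract (der p * q - p * der q) (q * q)"
    if q': "q' \<noteq> 0" and "Fract p q = Fract p' q'" for p' q'
  proof -
    have eq: "p * q' = p' * q"
      using that q by (simp add: eq_fract)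
    have d: "der p * q' + p * der q' = der p' * q + p' * der q"
      using arg_cong[OF eq, of der] by (simp add: der_mult)
    have "(der p' * q' - p' * der q') * (q * q) - (der p * q - p * der q) * (q' * q')
        = q * q' * ((der p' * q + p' * der q) - (der p * q' + p * der q'))
          + (p * q' - p' * q) * (der q * q' + q * der q')"
      by (simp add: algebra_simps)
    then have "(der p' * q' - p' * der q') * (q * q) = (der p * q - p * der q) * (q' * q')"
      using d eq by simp
    then show ?thesis
      using q q' by (simp add: eq_fract)
  qed
  show ?thesis
    unfolding der_fract_def by (rule the_equality) (use q unique in blast)+
qed

instance
proof
  fix x y :: "'a fract"
  obtain p q where x: "x = Fract p q" "q \<noteq> 0"
    by (cases x)
  obtain r s where y: "y = Fract r s" "s \<noteq> 0"
    by (cases y)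
  show "der (x + y) = der x + der y"
    using x y by (simp add: der_Fract eq_fract der_add der_mult algebra_simps)
  show "der (x * y) = der x * y + x * der y"
    using x y by (simp add: der_Fract eq_fract der_mult algebra_simps)
qed

end


section \<open>Rings of differential operators\<close>

text \<open>An element of \<open>R[\<partial>]\<close> is stored as the polynomial \<open>\<Sum> a\<^sub>i x\<^sup>i\<close> standing for
  \<open>\<Sum> a\<^sub>i \<partial>\<^sup>i\<close>; the product is the one determined by \<open>\<partial> a = a \<partial> + der a\<close>.\<close>

typedef (overloaded) 'a diffop = "UNIV :: 'a::zero poly set"
  morphisms symb Diffop ..

setup_lifting type_definition_diffop

text \<open>Left multiplication by \<open>\<partial>\<close>:
  \<open>\<partial> (\<Sum> b\<^sub>j \<partial>\<^sup>j) = \<Sum> (der b\<^sub>j \<partial>\<^sup>j + b\<^sub>j \<partial>\<^sup>j\<^sup>+\<^sup>1)\<close>.\<close>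

definition dleft :: "'a::differential_ring poly \<Rightarrow> 'a poly" where
  "dleft q = der q + pCons 0 q"

definition dmult :: "'a::differential_ring poly \<Rightarrow> 'a poly \<Rightarrow> 'a poly" where
  "dmult p q = (\<Sum>i\<le>degree p. smult (coeff p i) ((dleft ^^ i) q))"

lemma der_pCons: "der (pCons a p) = pCons (der a) (der p)" for p :: "'a::differential_ring poly"
  by (rule poly_eqI) (simp add: coeff_der_poly coeff_pCons split: nat.split)

lemma dleft_add: "dleft (p + q) = dleft p + dleft q"
  by (simp add: dleft_def der_add)

lemma dleft_smult: "dleft (smult a p) = smult (der a) p + smult a (dleft p)"
proof -
  have "der (smult a p) = smult (der a) p + smult a (der p)"
    by (rule poly_eqI) (simp add: coeff_der_poly der_mult)
  then show ?thesis
    by (simp add: dleft_def smult_add_right)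
qed

lemma dleft_0 [simp]: "dleft 0 = 0"
  by (simp add: dleft_def)

lemma funpow_dleft_add: "(dleft ^^ i) (p + q) = (dleft ^^ i) p + (dleft ^^ i) q"
  by (induction i) (auto simp: dleft_add)

lemma funpow_dleft_0 [simp]: "(dleft ^^ i) 0 = 0"
  by (induction i) auto

lemma smult_sum_right: "smult a (sum f A) = (\<Sum>x\<in>A. smult a (f x))"
  by (induction A rule: infinite_finite_induct) (auto simp: smult_add_right)

lemma dmult_bound:
  assumes "degree p \<le> n"
  shows "dmult p q = (\<Sum>i\<le>n. smult (coeff p i) ((dleft ^^ i) q))"
  unfolding dmult_def
  by (rule sum.mono_neutral_left) (use assms in \<open>auto simp: coeff_eq_0\<close>)

lemma dmult_add_left: "dmult (p + q) r = dmult p r + dmult q r"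
proof -
  define n where "n = max (degree p) (degree q)"
  have "degree (p + q) \<le> n" "degree p \<le> n" "degree q \<le> n"
    by (auto simp: n_def degree_add_le_max)
  then show ?thesis
    by (simp add: dmult_bound[of _ n] smult_add_left sum.distrib)
qed

lemma dmult_add_right: "dmult p (q + r) = dmult p q + dmult p r"
  by (simp add: dmult_def funpow_dleft_add smult_add_right sum.distrib)

lemma dmult_smult_left: "dmult (smult a p) r = smult a (dmult p r)"
proof -
  have "dmult (smult a p) r
      = (\<Sum>i\<le>degree p. smult (coeff (smult a p) i) ((dleft ^^ i) r))"
    by (rule dmult_bound) (rule degree_smult_le)
  then show ?thesis
    by (simp add: dmult_def smult_sum_right)
qed

lemma dmult_0_left [simp]: "dmult 0 r = 0"
  by (simp add: dmult_def)

lemma dmult_0_right [simp]: "dmult r 0 = 0"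
  by (simp add: dmult_def)

lemma dmult_pCons: "dmult (pCons a p) r = smult a r + dmult p (dleft r)"
proof -
  have "dmult (pCons a p) r
      = (\<Sum>i\<le>Suc (degree p). smult (coeff (pCons a p) i) ((dleft ^^ i) r))"
    by (rule dmult_bound) (rule degree_pCons_le)
  also have "\<dots> = smult a r + (\<Sum>i\<le>degree p. smult (coeff p i) ((dleft ^^ Suc i) r))"
    by (subst sum.atMost_Suc_shift) simp
  also have "(\<Sum>i\<le>degree p. smult (coeff p i) ((dleft ^^ Suc i) r)) = dmult p (dleft r)"
    by (simp add: dmult_def funpow_swap1)
  finally show ?thesis .
qed

lemma dleft_dmult: "dleft (dmult p r) = dmult (dleft p) r"
proof (induction p arbitrary: r)
  case 0
  then show ?case by simp
next
  case (pCons a p)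
  have "dleft (dmult (pCons a p) r)
      = smult (der a) r + smult a (dleft r) + dmult (dleft p) (dleft r)"
    by (simp add: dmult_pCons dleft_add dleft_smult pCons.IH)
  also have "\<dots> = dmult (dleft (pCons a p)) r"
    by (simp add: dleft_def[of p] dleft_def[of "pCons a p"] dmult_add_left der_pCons
        dmult_pCons ac_simps)
  finally show ?case .
qed

lemma dmult_assoc: "dmult (dmult p q) r = dmult p (dmult q r)"
proof (induction p arbitrary: q)
  case 0
  then show ?case by simp
next
  case (pCons a p)
  then show ?case
    by (simp add: dmult_pCons dmult_add_left dmult_smult_left dleft_dmult)
qed

lemma dmult_1_left: "dmult 1 p = p"
  by (simp add: one_pCons dmult_pCons)

lemma dmult_1_right: "dmult p 1 = p"
proof -
  have "dmult p (monom 1 n) = p * monom 1 n" for n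
  proof (induction p arbitrary: n)
    case (pCons a p)
    have "der (monom (1::'a) n) = 0"
      by (rule poly_eqI) (simp add: coeff_der_poly)
    then have "dleft (monom (1::'a) n) = monom 1 (Suc n)"
      by (simp add: dleft_def monom_Suc)
    then have "dmult (pCons a p) (monom 1 n) = smult a (monom 1 n) + p * monom 1 (Suc n)"
      by (simp only: dmult_pCons pCons.IH)
    then show ?case
      by (simp add: monom_Suc)
  qed simp
  from this[of 0] show ?thesis
    by simp
qed

instantiation diffop :: (differential_ring) ring_1
begin

lift_definition zero_diffop :: "'a diffop" is 0 .
lift_definition one_diffop :: "'a diffop" is 1 .
lift_definition plus_diffop :: "'a diffop \<Rightarrow> 'a diffop \<Rightarrow> 'a diffop" is "(+)" .
lift_definition minus_diffop :: "'a diffop \<Rightarrow> 'a diffop \<Rightarrow> 'a diffop" is "(-)" .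
lift_definition uminus_diffop :: "'a diffop \<Rightarrow> 'a diffop" is uminus .
lift_definition times_diffop :: "'a diffop \<Rightarrow> 'a diffop \<Rightarrow> 'a diffop" is dmult .

instance
  by standard
    (transfer; simp add: dmult_assoc dmult_1_left dmult_1_right dmult_add_left dmult_add_right)+

end

lift_definition op_const :: "'a::zero \<Rightarrow> 'a diffop" is "\<lambda>a. [:a:]" .

lift_definition op_D :: "'a::zero_neq_one diffop" is "[:0, 1:]" .

lift_definition op_coeff :: "'a::zero diffop \<Rightarrow> nat \<Rightarrow> 'a" is coeff .

lift_definition op_order :: "'a::zero diffop \<Rightarrow> nat" is degree .

lift_definition op_map :: "('a::zero \<Rightarrow> 'b::zero) \<Rightarrow> 'a diffop \<Rightarrow> 'b diffop" is map_poly .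

lemma op_D_const: "op_D * op_const a = op_const a * op_D + op_const (der a)"
  by transfer (simp add: dmult_pCons dleft_def der_pCons)

definition op_monic :: "'a::zero_neq_one diffop \<Rightarrow> bool" where
  "op_monic L \<longleftrightarrow> op_coeff L (op_order L) = 1"

definition op_apply :: "'a::differential_ring diffop \<Rightarrow> 'a \<Rightarrow> 'a" where
  "op_apply L y = (\<Sum>i\<le>op_order L. op_coeff L i * (der ^^ i) y)"

definition right_divides :: "'a::differential_ring diffop \<Rightarrow> 'a diffop \<Rightarrow> bool" where
  "right_divides G M \<longleftrightarrow> (\<exists>Q. M = Q * G)"

definition monic_gcrd :: "'a::differential_ring diffop \<Rightarrow> 'a diffop \<Rightarrow> 'a diffop \<Rightarrow> bool" where
  "monic_gcrd G M N \<longleftrightarrow> op_monic G \<and> right_divides G M \<and> right_divides G N \<and>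
     (\<forall>H. right_divides H M \<and> right_divides H N \<longrightarrow> right_divides H G)"


section \<open>Differential subfields, homomorphisms and extensions\<close>

definition is_subfield :: "'a::field set \<Rightarrow> bool" where
  "is_subfield S \<longleftrightarrow> 0 \<in> S \<and> 1 \<in> S \<and>
     (\<forall>x\<in>S. \<forall>y\<in>S. x + y \<in> S \<and> x - y \<in> S \<and> x * y \<in> S) \<and> (\<forall>x\<in>S. inverse x \<in> S)"

definition is_diff_subfield :: "'a::differential_field set \<Rightarrow> bool" where
  "is_diff_subfield S \<longleftrightarrow> is_subfield S \<and> (\<forall>x\<in>S. der x \<in> S)"

text \<open>\<open>is_diff_subfield hull (F \<union> X)\<close> is the differential field \<open>F\<langle>X\<rangle>\<close>, and
  \<open>is_subfield hull (F \<union> X)\<close> is the field \<open>F(X)\<close>.\<close>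

definition constants :: "'a::differential_ring set \<Rightarrow> 'a set" where
  "constants S = {x \<in> S. der x = 0}"

definition diff_hom_on ::
  "'a::differential_field set \<Rightarrow> ('a \<Rightarrow> 'b::differential_field) \<Rightarrow> bool" where
  "diff_hom_on S h \<longleftrightarrow> h 1 = 1 \<and>
     (\<forall>x\<in>S. \<forall>y\<in>S. h (x + y) = h x + h y \<and> h (x * y) = h x * h y) \<and>
     (\<forall>x\<in>S. h (der x) = der (h x))"

text \<open>\<open>\<iota>\<close> identifies \<open>\<complex>\<close> with the field of constants of the differential field \<open>'a\<close>.\<close>

definition constant_field_embedding :: "(complex \<Rightarrow> 'a::differential_field) \<Rightarrow> bool" where
  "constant_field_embedding \<iota> \<longleftrightarrow> \<iota> 1 = 1 \<and>
     (\<forall>x y. \<iota> (x + y) = \<iota> x + \<iota> y \<and> \<iota> (x * y) = \<iota> x * \<iota> y) \<and>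
     range \<iota> = constants UNIV"

definition polys_over :: "'a::zero set \<Rightarrow> 'a poly set" where
  "polys_over S = {p. \<forall>i. coeff p i \<in> S}"

definition ratfuns_over :: "'a::field set \<Rightarrow> 'a poly fract set" where
  "ratfuns_over S = {Fract p q | p q. p \<in> polys_over S \<and> q \<in> polys_over S \<and> q \<noteq> 0}"

definition algebraic_over :: "'a::field set \<Rightarrow> 'a \<Rightarrow> bool" where
  "algebraic_over F x \<longleftrightarrow> (\<exists>p\<in>polys_over F. p \<noteq> 0 \<and> poly p x = 0)"

definition transcendental_extension :: "'a::field set \<Rightarrow> 'a set \<Rightarrow> bool" where
  "transcendental_extension F E \<longleftrightarrow> F \<subseteq> E \<and> (\<exists>x\<in>E. \<not> algebraic_over F x)"

inductive liouvillian_extension ::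
  "'a::differential_field set \<Rightarrow> 'a set \<Rightarrow> bool" for F where
  refl: "liouvillian_extension F F"
| algebraic: "liouvillian_extension F E \<Longrightarrow> algebraic_over E t \<Longrightarrow>
    liouvillian_extension F (is_subfield hull (insert t E))"
| integral: "liouvillian_extension F E \<Longrightarrow> der t \<in> E \<Longrightarrow>
    liouvillian_extension F (is_subfield hull (insert t E))"
| exponential: "liouvillian_extension F E \<Longrightarrow> t \<noteq> 0 \<Longrightarrow> der t / t \<in> E \<Longrightarrow>
    liouvillian_extension F (is_subfield hull (insert t E))"


section \<open>Differential closure\<close>

text \<open>Differential polynomials in one differential indeterminate \<open>y\<close>: a monomial
  \<open>m :: nat \<Rightarrow>\<^sub>0 nat\<close> stands for \<open>\<Prod> (y\<^sup>(\<^sup>i\<^sup>))\<^sup>m\<^sup>(\<^sup>i\<^sup>)\<close>.\<close>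

type_synonym 'a dpoly = "(nat \<Rightarrow>\<^sub>0 nat) \<Rightarrow>\<^sub>0 'a"

definition dpoly_vars :: "'a::zero dpoly \<Rightarrow> nat set" where
  "dpoly_vars p = (\<Union>m\<in>Poly_Mapping.keys p. Poly_Mapping.keys m)"

definition dpoly_eval :: "'a::differential_ring dpoly \<Rightarrow> 'a \<Rightarrow> 'a" where
  "dpoly_eval p a = (\<Sum>m\<in>Poly_Mapping.keys p. Poly_Mapping.lookup p m *
     (\<Prod>i\<in>Poly_Mapping.keys m. ((der ^^ i) a) ^ Poly_Mapping.lookup m i))"

definition dpolys_over :: "'a::zero set \<Rightarrow> 'a dpoly set" where
  "dpolys_over S = {p. \<forall>m. Poly_Mapping.lookup p m \<in> S}"

text \<open>Blum's axioms: if \<open>f\<close> has order \<open>n\<close> and \<open>g \<noteq> 0\<close> has order less than \<open>n\<close>, then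
  \<open>f = 0 \<noteq> g\<close> is solvable.  For \<open>n = 0\<close> the polynomial \<open>g\<close> is a nonzero constant and the
  axiom says that the field is algebraically closed.\<close>

definition differentially_closed :: "'a::differential_field set \<Rightarrow> bool" where
  "differentially_closed M \<longleftrightarrow> is_diff_subfield M \<and>
     (\<forall>n. \<forall>f\<in>dpolys_over M. \<forall>g\<in>dpolys_over M.
        n \<in> dpoly_vars f \<and> dpoly_vars f \<subseteq> {..n} \<and> g \<noteq> 0 \<and> dpoly_vars g \<subseteq> {..<n} \<longrightarrow>
        (\<exists>a\<in>M. dpoly_eval f a = 0 \<and> dpoly_eval g a \<noteq> 0))"

text \<open>A differential closure of \<open>F\<close> is a differentially closed extension of \<open>F\<close> that embeds
  over \<open>F\<close> into every differentially closed extension of \<open>F\<close>.  Here the closure is the whole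
  type \<open>'a\<close>, and the embedding is only asked for differentially closed \<open>M\<close> between \<open>F\<close> and
  \<open>'a\<close>, as HOL does not quantify over types.  This loses nothing: a differential closure of
  \<open>F\<close> exists, it embeds over \<open>F\<close> into \<open>'a\<close>, and its image is such an \<open>M\<close>; an embedding of
  \<open>'a\<close> into it composes to embeddings into all differentially closed extensions.\<close>

definition differential_closure_of :: "'a::differential_field set \<Rightarrow> bool" where
  "differential_closure_of F \<longleftrightarrow> is_diff_subfield F \<and>
     differentially_closed (UNIV :: 'a set) \<and>
     (\<forall>M. F \<subseteq> M \<and> differentially_closed M \<longrightarrow>
        (\<exists>h :: 'a \<Rightarrow> 'a. diff_hom_on UNIV h \<and> range h \<subseteq> M \<and> (\<forall>x\<in>F. h x = x)))"


section \<open>Algebro-geometric operators and their partners\<close>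

text \<open>\<open>const_algebra \<iota> X\<close> is the \<open>\<complex>\<close>-algebra of operators generated by \<open>X\<close>: \<open>\<complex>[\<partial>]\<close>,
  \<open>\<complex>[L]\<close> and \<open>\<complex>[L, A]\<close> for \<open>X = {op_D}\<close>, \<open>{L}\<close> and \<open>{L, A}\<close>.\<close>

inductive_set const_algebra ::
  "(complex \<Rightarrow> 'a::differential_ring) \<Rightarrow> 'a diffop set \<Rightarrow> 'a diffop set"
  for \<iota> X where
  const: "op_const (\<iota> c) \<in> const_algebra \<iota> X"
| gen: "P \<in> X \<Longrightarrow> P \<in> const_algebra \<iota> X"
| add: "P \<in> const_algebra \<iota> X \<Longrightarrow> Q \<in> const_algebra \<iota> X \<Longrightarrow> P + Q \<in> const_algebra \<iota> X"
| mult: "P \<in> const_algebra \<iota> X \<Longrightarrow> Q \<in> const_algebra \<iota> X \<Longrightarrow> P * Q \<in> const_algebra \<iota> X"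

definition centralizer :: "'a::differential_ring diffop \<Rightarrow> 'a diffop set" where
  "centralizer L = {P. L * P - P * L = 0}"

definition algebro_geometric ::
  "(complex \<Rightarrow> 'a::differential_field) \<Rightarrow> 'a diffop \<Rightarrow> bool" where
  "algebro_geometric \<iota> L \<longleftrightarrow> L \<notin> const_algebra \<iota> {op_D} \<and>
     (\<exists>P. P \<noteq> 0 \<and> coprime (op_order P) (op_order L) \<and> L * P - P * L = 0)"

definition schroedinger :: "'a::differential_field \<Rightarrow> 'a diffop" where
  "schroedinger u = - (op_D * op_D) + op_const u"

definition eval_at_op ::
  "(complex \<Rightarrow> 'a::differential_ring) \<Rightarrow> complex poly \<Rightarrow> 'a diffop \<Rightarrow> 'a diffop" where
  "eval_at_op \<iota> R L = (\<Sum>i\<le>degree R. op_const (\<iota> (coeff R i)) * L ^ i)"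

definition partner ::
  "(complex \<Rightarrow> 'a::differential_field) \<Rightarrow> nat \<Rightarrow> 'a diffop \<Rightarrow> 'a diffop \<Rightarrow> complex poly \<Rightarrow> bool"
where
  "partner \<iota> s L A R \<longleftrightarrow>
     op_monic A \<and> op_order A = 2 * s + 1 \<and>
     A \<in> centralizer L - const_algebra \<iota> {L} \<and>
     (\<forall>B \<in> centralizer L - const_algebra \<iota> {L}. op_order A \<le> op_order B) \<and>
     centralizer L = const_algebra \<iota> {L, A} \<and>
     degree R = 2 * s + 1 \<and> A\<^sup>2 + eval_at_op \<iota> R L = 0"


section \<open>The spectral curve and its function fields\<close>

definition spectral_curve :: "complex poly \<Rightarrow> (complex \<times> complex) set" where
  "spectral_curve R = {(a, b). b\<^sup>2 + poly R a = 0}"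

text \<open>Polynomials in \<open>\<lambda>\<close> and \<open>\<mu>\<close> have type \<open>'a poly poly\<close>, with \<open>\<lambda>\<close> the inner and \<open>\<mu>\<close> the
  outer indeterminate; \<open>polys_over (polys_over S)\<close> is \<open>S[\<lambda>, \<mu>]\<close>.\<close>

definition var_lam :: "'a::comm_semiring_1 poly poly" where
  "var_lam = [:[:0, 1:]:]"

definition var_mu :: "'a::comm_semiring_1 poly poly" where
  "var_mu = [:0, 1:]"

definition spectral_poly :: "(complex \<Rightarrow> 'a::comm_semiring_1) \<Rightarrow> complex poly \<Rightarrow> 'a poly poly" where
  "spectral_poly \<iota> R = var_mu\<^sup>2 + [:map_poly \<iota> R:]"

definition fractions_of ::
  "('a::zero poly poly \<Rightarrow> 'g::field) \<Rightarrow> 'a set \<Rightarrow> 'g set" where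
  "fractions_of \<pi> S = {\<pi> p / \<pi> q | p q.
     p \<in> polys_over (polys_over S) \<and> q \<in> polys_over (polys_over S) \<and> \<pi> q \<noteq> 0}"

text \<open>The differential field \<open>'g\<close> is \<open>K(\<Gamma>)\<close>, the fraction field of \<open>K[\<lambda>, \<mu>]/(f)\<close> with the
  derivation induced from \<open>K[\<lambda>, \<mu>]\<close>, where \<open>\<pi>\<close> is the canonical map \<open>K[\<lambda>, \<mu>] \<rightarrow> K(\<Gamma>)\<close>.  As
  \<open>f\<close> is monic in \<open>\<mu>\<close> with coefficients in \<open>\<complex>\<close>, one has \<open>f K[\<lambda>, \<mu>] \<inter> \<complex>[\<lambda>, \<mu>] = f \<complex>[\<lambda>, \<mu>]\<close>, so
  that \<open>\<complex>(\<Gamma>)\<close> is the subfield \<open>fractions_of \<pi> (range \<iota>)\<close>.\<close>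

definition function_field ::
  "'a::differential_field set \<Rightarrow> 'a poly poly \<Rightarrow> ('a poly poly \<Rightarrow> 'g::differential_field) \<Rightarrow> bool"
where
  "function_field K f \<pi> \<longleftrightarrow> \<pi> 1 = 1 \<and>
     (\<forall>p \<in> polys_over (polys_over K). \<forall>q \<in> polys_over (polys_over K).
        \<pi> (p + q) = \<pi> p + \<pi> q \<and> \<pi> (p * q) = \<pi> p * \<pi> q) \<and>
     (\<forall>p \<in> polys_over (polys_over K).
        \<pi> p = 0 \<longleftrightarrow> (\<exists>q \<in> polys_over (polys_over K). p = f * q)) \<and>
     fractions_of \<pi> K = UNIV \<and>
     (\<forall>p \<in> polys_over (polys_over K). der (\<pi> p) = \<pi> (der p))"

abbreviation (input) coeff_embedding ::
  "('a::zero poly poly \<Rightarrow> 'g) \<Rightarrow> 'a \<Rightarrow> 'g" where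
  "coeff_embedding \<pi> a \<equiv> \<pi> [:[:a:]:]"


section \<open>Rational parametrizations\<close>

definition ratfun_defined :: "complex poly fract \<Rightarrow> complex \<Rightarrow> bool" where
  "ratfun_defined x t \<longleftrightarrow> poly (snd (quot_of_fract x)) t \<noteq> 0"

definition ratfun_eval :: "complex poly fract \<Rightarrow> complex \<Rightarrow> complex" where
  "ratfun_eval x t = poly (fst (quot_of_fract x)) t / poly (snd (quot_of_fract x)) t"

definition eval2 :: "complex poly poly \<Rightarrow> complex \<times> complex \<Rightarrow> complex" where
  "eval2 P z = poly (poly P [:snd z:]) (fst z)"

text \<open>The map \<open>t \<mapsto> (\<chi>\<^sub>1(t), \<chi>\<^sub>2(t))\<close> is a birational equivalence between \<open>\<P>\<^sup>1\<close> and the closure of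
  \<open>\<Gamma>\<close> in \<open>\<P>\<^sup>2\<close>: it has a rational inverse \<open>N/M\<close>, where both composites are the identity up to
  finitely many points.  Affine points suffice, since the affine line and \<open>\<Gamma>\<close> have finite
  complement in \<open>\<P>\<^sup>1\<close> and in the closure.\<close>

definition rational_parametrization ::
  "complex poly \<Rightarrow> complex poly fract \<Rightarrow> complex poly fract \<Rightarrow> bool" where
  "rational_parametrization R \<chi>1 \<chi>2 \<longleftrightarrow> (\<exists>N M.
     finite {t. \<not> (ratfun_defined \<chi>1 t \<and> ratfun_defined \<chi>2 t \<and>
        (let z = (ratfun_eval \<chi>1 t, ratfun_eval \<chi>2 t)
         in z \<in> spectral_curve R \<and> eval2 M z \<noteq> 0 \<and> eval2 N z / eval2 M z = t))} \<and>
     finite {z \<in> spectral_curve R. \<not> (eval2 M z \<noteq> 0 \<and>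
        (let t = eval2 N z / eval2 M z
         in ratfun_defined \<chi>1 t \<and> ratfun_defined \<chi>2 t \<and>
            z = (ratfun_eval \<chi>1 t, ratfun_eval \<chi>2 t)))})"

text \<open>The inclusion of \<open>\<complex>(\<tau>)\<close> into the rational functions over \<open>'a\<close>.\<close>

definition ratfun_map :: "(complex \<Rightarrow> 'a::field) \<Rightarrow> complex poly fract \<Rightarrow> 'a poly fract" where
  "ratfun_map \<iota> x =
     Fract (map_poly \<iota> (fst (quot_of_fract x))) (map_poly \<iota> (snd (quot_of_fract x)))"

text \<open>\<open>\<rho>\<close> is the isomorphism of differential fields \<open>K(\<Gamma>) \<rightarrow> K(\<tau>)\<close> over \<open>K\<close> that extends the
  isomorphism \<open>\<complex>(\<Gamma>) \<rightarrow> \<complex>(\<tau>)\<close>, \<open>\<lambda> \<mapsto> \<chi>\<^sub>1\<close>, \<open>\<mu> \<mapsto> \<chi>\<^sub>2\<close>.\<close>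

definition parametrization_iso ::
  "(complex \<Rightarrow> 'a::differential_field) \<Rightarrow> 'a set \<Rightarrow> ('a poly poly \<Rightarrow> 'g::differential_field) \<Rightarrow>
   complex poly fract \<Rightarrow> complex poly fract \<Rightarrow> ('g \<Rightarrow> 'a poly fract) \<Rightarrow> bool"
where
  "parametrization_iso \<iota> K \<pi> \<chi>1 \<chi>2 \<rho> \<longleftrightarrow>
     diff_hom_on UNIV \<rho> \<and> bij_betw \<rho> UNIV (ratfuns_over K) \<and>
     (\<forall>a\<in>K. \<rho> (coeff_embedding \<pi> a) = Fract [:a:] 1) \<and>
     bij_betw \<rho> (fractions_of \<pi> (range \<iota>)) (ratfuns_over (range \<iota>)) \<and>
     \<rho> (\<pi> var_lam) = ratfun_map \<iota> \<chi>1 \<and> \<rho> (\<pi> var_mu) = ratfun_map \<iota> \<chi>2"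

end

theory Submission
  imports Defs
begin

text \<open>Write \<open>F = K(\<tau>)\<close> and let \<open>\<phi>\<close> be the coefficient of the intrinsic right factor, so that
  \<open>\<phi>' + \<phi>\<^sup>2 = u - \<chi>\<^sub>1(\<tau>)\<close>.  Everything rests on one fact about \<open>F\<close>: no power of a solution is
  proportional to an element of \<open>F\<close>, that is, \<open>b' = n \<phi> b\<close> with \<open>n \<ge> 1\<close> forces \<open>b = 0\<close> in \<open>F\<close>
  (\<open>log_free_intrinsic_factor\<close>).

  The reason is a comparison of poles in \<open>\<tau>\<close>.  As \<open>\<tau>\<close> is a constant, differentiating a Laurent
  expansion at a point of \<open>\<P>\<^sup>1(\<complex>)\<close> only differentiates its coefficients.  Hence a logarithmic
  derivative \<open>b'/b\<close> has no pole at any such point, and the functions regular at the point form a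
  ring closed under the derivation.  If \<open>\<phi> = b'/(n b)\<close>, then \<open>\<chi>\<^sub>1 = u - \<phi>' - \<phi>\<^sup>2\<close> has no pole on
  \<open>\<P>\<^sup>1(\<complex>)\<close>, so it is a constant \<open>c\<close>.  But \<open>\<chi>\<^sub>1\<close> corresponds to \<open>\<lambda>\<close> in \<open>K(\<Gamma>)\<close>, and \<open>\<lambda> - c\<close> is not a
  multiple of \<open>\<mu>\<^sup>2 + R(\<lambda>)\<close>.

  The rest is the theory of an exponential \<open>y' = \<phi> y\<close> with this property.  The derivation of
  \<open>F[X]\<close> with \<open>X' = \<phi> X\<close> multiplies \<open>X\<^sup>d\<close> by \<open>d \<phi>\<close>, and its eigenvectors for the eigenvalue
  \<open>d \<phi>\<close> are only the multiples of \<open>X\<^sup>d\<close> (\<open>eigenvector_monomial\<close>).  A monic polynomial of minimal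
  degree \<open>d\<close> that vanishes at \<open>y\<close>, or that is the denominator of a constant of \<open>F(y)\<close>, is such
  an eigenvector, because subtracting \<open>d \<phi>\<close> times it from its derivative leaves a polynomial of
  lower degree with the same property.  So it equals \<open>X\<^sup>d\<close>.  Since \<open>y \<noteq> 0\<close>, this makes \<open>y\<close>
  transcendental and puts the constants of \<open>F(y)\<close> into \<open>F\<close>, where they are the elements of
  \<open>\<complex>(\<tau>)\<close>.\<close>

section \<open>Places of the field of rational functions\<close>

text \<open>The features of the valuation ring of a place that is trivial on \<open>K\<close> and compatible with
  the derivation; the property of being a valuation ring is replaced by the one consequence that
  matters, the regularity of logarithmic derivatives.\<close>

definition log_closed_ring :: "'a::differential_field poly fract set \<Rightarrow> bool" where
  "log_closed_ring V \<longleftrightarrow> (\<forall>a. Fract [:a:] 1 \<in> V) \<and>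
     (\<forall>x\<in>V. \<forall>y\<in>V. x + y \<in> V \<and> x * y \<in> V) \<and> (\<forall>x\<in>V. der x \<in> V) \<and>
     (\<forall>b. b \<noteq> 0 \<longrightarrow> der b / b \<in> V)"

definition regular_at :: "'a::differential_field \<Rightarrow> 'a poly fract set" where
  "regular_at t = {Fract p q | p q. poly q t \<noteq> 0}"

definition regular_at_infinity :: "'a::differential_field poly fract set" where
  "regular_at_infinity = {Fract p q | p q. q \<noteq> 0 \<and> degree p \<le> degree q}"

lemma degree_der_le: "degree (der p) \<le> degree p" for p :: "'a::differential_ring poly"
  by (rule degree_le) (simp add: coeff_der_poly coeff_eq_0)

lemma der_Fract_div_self:
  fixes p q :: "'a::differential_field poly"
  assumes "p \<noteq> 0" "q \<noteq> 0"
  shows "der (Fract p q) / Fract p q = Fract (der p * q - p * der q) (p * q)"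
  using assms by (simp add: der_Fract eq_fract algebra_simps)

text \<open>Differentiation acts on coefficients and so does not raise degrees; this gives both the
  closure under the derivation and the regularity of \<open>b'/b = (p'q - p q')/(p q)\<close>.\<close>

lemma log_closed_regular_at_infinity: "log_closed_ring regular_at_infinity"
proof -
  have deg: "degree (a * b) \<le> degree (c * d)"
    if "degree a \<le> degree c" "degree b \<le> degree d" "c \<noteq> 0" "d \<noteq> 0" for a b c d :: "'a poly"
    using degree_mult_le[of a b] that by (simp add: degree_mult_eq)
  have mem: "Fract p q \<in> regular_at_infinity" if "q \<noteq> 0" "degree p \<le> degree q" for p q :: "'a poly"
    using that by (auto simp: regular_at_infinity_def)
  have dd: "degree (der p * q - p * der q) \<le> degree (c * q)"
    if "degree p \<le> degree c" "c \<noteq> 0" "q \<noteq> 0" for p q c :: "'a poly"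
    by (intro degree_diff_le deg) (use that degree_der_le order_trans in \<open>blast+\<close>)
  show ?thesis
    unfolding log_closed_ring_def
  proof (intro conjI ballI allI impI)
    show "Fract [:a:] 1 \<in> regular_at_infinity" for a :: 'a
      by (rule mem) auto
  next
    fix x y :: "'a poly fract"
    assume "x \<in> regular_at_infinity" "y \<in> regular_at_infinity"
    then obtain p q r s where *: "x = Fract p q" "q \<noteq> 0" "degree p \<le> degree q"
      "y = Fract r s" "s \<noteq> 0" "degree r \<le> degree s"
      unfolding regular_at_infinity_def by blast
    show "x + y \<in> regular_at_infinity"
      using * mem[of "q * s" "p * s + r * q"] deg[of p q s s] deg[of r s q q]
      by (simp add: degree_add_le mult.commute)
    show "x * y \<in> regular_at_infinity"
      using * mem[of "q * s" "p * r"] deg[of p q r s] by simp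
  next
    fix x :: "'a poly fract"
    assume "x \<in> regular_at_infinity"
    then obtain p q where "x = Fract p q" "q \<noteq> 0" "degree p \<le> degree q"
      unfolding regular_at_infinity_def by blast
    then show "der x \<in> regular_at_infinity"
      using dd[of p q q] mem[of "q * q"] by (simp add: der_Fract)
  next
    fix b :: "'a poly fract"
    assume b: "b \<noteq> 0"
    obtain p q where pq: "b = Fract p q" "q \<noteq> 0"
      by (cases b)
    with b have "p \<noteq> 0" by (auto simp: eq_fract Zero_fract_def)
    then show "der b / b \<in> regular_at_infinity"
      using pq dd[of p p q] mem[of "p * q"] by (simp add: der_Fract_div_self)
  qed
qed

lemma der_linear_power:
  fixes t :: "'a::differential_field"
  assumes "der t = 0"
  shows "der ([:- t, 1:] ^ k) = 0"
proof (induction k)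
  case (Suc k)
  have "der [:- t, 1:] = 0"
    using assms by (simp add: der_pCons der_minus)
  with Suc show ?case
    by (simp only: power_Suc der_mult mult_zero_left mult_zero_right add_0_left)
qed simp

text \<open>A power of \<open>X - t\<close> is a constant, so it cancels from \<open>b'/b\<close> once \<open>b\<close> is written as such a
  power times a unit at \<open>t\<close>.\<close>

lemma log_closed_regular_at:
  fixes t :: "'a::differential_field"
  assumes t: "der t = 0"
  shows "log_closed_ring (regular_at t)"
proof -
  have mem: "Fract p q \<in> regular_at t" if "poly q t \<noteq> 0" for p q
    using that by (auto simp: regular_at_def)
  show ?thesis
    unfolding log_closed_ring_def
  proof (intro conjI ballI allI impI)
    show "Fract [:a:] 1 \<in> regular_at t" for a
      by (rule mem) simp
  next
    fix x y
    assume "x \<in> regular_at t" "y \<in> regular_at t"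
    then obtain p q r s where *: "x = Fract p q" "poly q t \<noteq> 0" "y = Fract r s" "poly s t \<noteq> 0"
      unfolding regular_at_def by blast
    then have "q \<noteq> 0" "s \<noteq> 0" by auto
    then show "x + y \<in> regular_at t" "x * y \<in> regular_at t"
      using * mem[of "q * s"] by simp_all
  next
    fix x
    assume "x \<in> regular_at t"
    then obtain p q where *: "x = Fract p q" "poly q t \<noteq> 0"
      unfolding regular_at_def by blast
    then have "q \<noteq> 0" by auto
    then show "der x \<in> regular_at t"
      using * mem[of "q * q"] by (simp add: der_Fract)
  next
    fix b :: "'a poly fract"
    assume b: "b \<noteq> 0"
    obtain p q where pq: "b = Fract p q" "q \<noteq> 0"
      by (cases b)
    with b have p: "p \<noteq> 0" by (auto simp: eq_fract Zero_fract_def)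
    have split: "\<exists>k p'. p = [:- t, 1:] ^ k * p' \<and> poly p' t \<noteq> 0" if "p \<noteq> 0" for p
      using order_decomp[OF that, of t] by (auto simp: poly_eq_0_iff_dvd)
    obtain k p' where p': "p = [:- t, 1:] ^ k * p'" "poly p' t \<noteq> 0"
      using split p by blast
    obtain l q' where q': "q = [:- t, 1:] ^ l * q'" "poly q' t \<noteq> 0"
      using split pq by blast
    have nz: "p' \<noteq> 0" "q' \<noteq> 0" "[:- t, 1:] ^ (k + l) \<noteq> 0"
      using p' q' by auto
    define w where "w = [:- t, 1:] ^ (k + l)"
    have "der p * q - p * der q = w * (der p' * q' - p' * der q')" "p * q = w * (p' * q')"
      using p' q' t by (simp_all add: w_def der_mult der_linear_power power_add algebra_simps)
    then have "der b / b = Fract (w * (der p' * q' - p' * der q')) (w * (p' * q'))"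
      using pq p by (simp add: der_Fract_div_self)
    also have "\<dots> = Fract (der p' * q' - p' * der q') (p' * q')"
      using nz by (simp add: mult_fract_cancel w_def)
    also have "\<dots> \<in> regular_at t"
      by (rule mem) (use p' q' in simp)
    finally show "der b / b \<in> regular_at t" .
  qed
qed

lemma of_nat_fract_poly: "of_nat n = Fract [:of_nat n:] (1 :: 'a::field poly)"
  by (simp add: of_nat_fract of_nat_poly)

text \<open>A solution \<open>\<phi>\<close> of the Riccati equation that is a logarithmic derivative up to the factor
  \<open>n\<close> lies in \<open>V\<close>, and so does the potential computed from it.\<close>

lemma riccati_potential_regular:
  fixes b \<phi> x :: "'a::differential_field poly fract"
  assumes V: "log_closed_ring V"
    and b: "b \<noteq> 0" "der b = of_nat n * \<phi> * b" and n: "of_nat n \<noteq> (0::'a)"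
    and riccati: "der \<phi> + \<phi>\<^sup>2 = Fract [:v:] 1 - x"
  shows "x \<in> V"
proof -
  note V = V[unfolded log_closed_ring_def, rule_format]
  have inv: "Fract [:inverse (of_nat n):] 1 * of_nat n = (1 :: 'a poly fract)"
    using n by (simp add: of_nat_fract_poly One_fract_def one_pCons)
  have "\<phi> = Fract [:inverse (of_nat n):] 1 * (der b / b)"
    using b inv by (simp add: mult.assoc[symmetric])
  then have \<phi>: "\<phi> \<in> V"
    using V b(1) by metis
  have "x = Fract [:v:] 1 + Fract [:- 1:] 1 * (der \<phi> + \<phi>\<^sup>2)"
  proof -
    have "Fract [:- 1:] 1 = (- 1 :: 'a poly fract)"
      by (simp add: One_fract_def one_pCons)
    then show ?thesis
      by (simp add: riccati)
  qed
  also have "\<dots> \<in> V"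
    using V \<phi> by (metis power2_eq_square)
  finally show ?thesis .
qed


section \<open>Complex rational functions and constants\<close>

lemma constant_embedding_hom:
  assumes "constant_field_embedding \<iota>"
  shows "\<iota> 0 = 0" "\<iota> 1 = 1" "\<iota> (x + y) = \<iota> x + \<iota> y" "\<iota> (x * y) = \<iota> x * \<iota> y"
    "\<iota> x = 0 \<longleftrightarrow> x = 0" "\<iota> (of_nat n) = of_nat n" "der (\<iota> x) = 0"
proof -
  note h = assms[unfolded constant_field_embedding_def]
  show a: "\<iota> 1 = 1" "\<iota> (x + y) = \<iota> x + \<iota> y" "\<iota> (x * y) = \<iota> x * \<iota> y" for x y
    using h by auto
  show z: "\<iota> 0 = 0"
    using a(2)[of 0 0] by (metis add_0 add_cancel_right_right)
  show "\<iota> x = 0 \<longleftrightarrow> x = 0"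
    using a(3)[of x "inverse x"] a(1) z by (cases "x = 0") auto
  show "\<iota> (of_nat n) = of_nat n"
    by (induction n) (use a z in auto)
  show "der (\<iota> x) = 0"
    using h by (auto simp: constants_def)
qed

lemma constant_embedding_poly:
  assumes "constant_field_embedding \<iota>"
  shows "poly (map_poly \<iota> p) (\<iota> t) = \<iota> (poly p t)" "degree (map_poly \<iota> p) = degree p"
    "map_poly \<iota> p = 0 \<longleftrightarrow> p = 0"
proof -
  note h = constant_embedding_hom[OF assms]
  show "poly (map_poly \<iota> p) (\<iota> t) = \<iota> (poly p t)"
    by (induction p) (simp_all add: map_poly_pCons h)
  show "degree (map_poly \<iota> p) = degree p" "map_poly \<iota> p = 0 \<longleftrightarrow> p = 0"
    by (simp_all add: degree_map_poly h map_poly_eq_0_iff)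
qed

text \<open>A function without poles on the projective line is constant.  Regularity over \<open>K\<close> is only
  known at the points of \<open>\<P>\<^sup>1(\<complex>)\<close>, which suffices as the denominator splits over \<open>\<complex>\<close>.\<close>

lemma everywhere_regular_imp_constant:
  assumes \<iota>: "constant_field_embedding \<iota>"
    and infinity: "ratfun_map \<iota> \<chi> \<in> regular_at_infinity"
    and finite: "\<And>t. ratfun_map \<iota> \<chi> \<in> regular_at (\<iota> t)"
  shows "\<exists>c. ratfun_map \<iota> \<chi> = Fract [:\<iota> c:] 1"
proof -
  note h = constant_embedding_hom[OF \<iota>] constant_embedding_poly[OF \<iota>]
  define n d where "n = fst (quot_of_fract \<chi>)" and "d = snd (quot_of_fract \<chi>)"
  have x: "ratfun_map \<iota> \<chi> = Fract (map_poly \<iota> n) (map_poly \<iota> d)"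
    by (simp add: ratfun_map_def n_def d_def)
  have d: "d \<noteq> 0" and coprime: "coprime n d"
    by (simp_all add: n_def d_def coprime_quot_of_fract)
  have "poly d t \<noteq> 0" for t
  proof
    assume dt: "poly d t = 0"
    obtain p q where "ratfun_map \<iota> \<chi> = Fract p q" "poly q (\<iota> t) \<noteq> 0"
      using finite[of t] unfolding regular_at_def by blast
    moreover from this have "q \<noteq> 0" by auto
    ultimately have "map_poly \<iota> n * q = p * map_poly \<iota> d" and q: "poly q (\<iota> t) \<noteq> 0"
      using x d h by (auto simp: eq_fract(1))
    from arg_cong[OF this(1), of "\<lambda>p. poly p (\<iota> t)"] q dt h have "poly n t = 0"
      by auto
    with dt coprime show False
      by (metis coprime_poly_0)
  qed
  then have d0: "degree d = 0"
    using fundamental_theorem_of_algebra[of d] by (auto simp: constant_degree)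
  obtain p q where "ratfun_map \<iota> \<chi> = Fract p q" "q \<noteq> 0" and le: "degree p \<le> degree q"
    using infinity unfolding regular_at_infinity_def by blast
  then have "map_poly \<iota> n * q = p * map_poly \<iota> d"
    using x d h by (auto simp: eq_fract(1))
  then have "degree (map_poly \<iota> n * q) \<le> degree q"
    using le d0 h degree_mult_le[of p "map_poly \<iota> d"] by simp
  then have "degree n = 0"
    using \<open>q \<noteq> 0\<close> h by (cases "n = 0") (auto simp: degree_mult_eq)
  then obtain a c where ac: "n = [:a:]" "d = [:c:]"
    using d0 by (metis degree_eq_zeroE)
  then have "c \<noteq> 0" using d by auto
  have "\<iota> c * \<iota> (a / c) = \<iota> a"
    using \<open>c \<noteq> 0\<close> by (simp flip: h(4))
  then have "ratfun_map \<iota> \<chi> = Fract [:\<iota> (a / c):] 1"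
    using \<open>c \<noteq> 0\<close> by (simp add: x ac map_poly_pCons eq_fract h mult.commute)
  then show ?thesis ..
qed

text \<open>In a fraction \<open>p/q\<close> with monic denominator of minimal degree, \<open>q'\<close> has lower degree than
  \<open>q\<close>.  A vanishing derivative means \<open>p' q = p q'\<close>, so \<open>q' \<noteq> 0\<close> would give the representation
  \<open>p'/q'\<close> with a smaller denominator.\<close>

lemma constant_ratfun:
  fixes x :: "'a::differential_field poly fract"
  assumes "der x = 0"
  shows "x \<in> ratfuns_over (constants UNIV)"
proof -
  define P where "P m \<longleftrightarrow> (\<exists>p q. x = Fract p q \<and> q \<noteq> 0 \<and> degree q = m)" for m
  have "\<exists>m. P m"
    by (cases x) (auto simp: P_def)
  then have "P (LEAST m. P m)"
    by (rule LeastI_ex)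
  then obtain p0 q0 where 0: "x = Fract p0 q0" "q0 \<noteq> 0" "degree q0 = (LEAST m. P m)"
    by (auto simp: P_def)
  define a where "a = inverse (lead_coeff q0)"
  define p q where "p = smult a p0" and "q = smult a q0"
  have "a \<noteq> 0" using 0(2) by (simp add: a_def)
  then have x: "x = Fract p q" and q: "q \<noteq> 0" and same: "degree q = degree q0"
    using 0(1,2) by (simp_all add: p_def q_def eq_fract)
  have deg: "degree q = (LEAST m. P m)"
    using same 0(3) by simp
  have monic: "lead_coeff q = 1"
    unfolding same using 0(2) by (simp add: q_def a_def)
  have rel: "der p * q = p * der q"
    using assms q by (simp add: x der_Fract Zero_fract_def eq_fract)
  have "der q = 0"
  proof (rule ccontr)
    assume nz: "der q \<noteq> 0"
    then have "x = Fract (der p) (der q)"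
      using rel q by (simp add: x eq_fract)
    then have "P (degree (der q))"
      using nz by (auto simp: P_def)
    then have "degree q \<le> degree (der q)"
      unfolding deg by (rule Least_le)
    then have eq: "degree (der q) = degree q"
      using degree_der_le[of q] by simp
    have "lead_coeff (der q) = 0"
      using monic by (simp add: eq coeff_der_poly)
    with nz show False by simp
  qed
  with rel q have "der p = 0" by simp
  have "p \<in> polys_over (constants UNIV)" "q \<in> polys_over (constants UNIV)"
    using \<open>der p = 0\<close> \<open>der q = 0\<close>
    by (auto simp: polys_over_def constants_def simp flip: coeff_der_poly)
  with x q show ?thesis
    unfolding ratfuns_over_def by blast
qed

lemma der_ratfun_over_constants:
  fixes x :: "'a::differential_field poly fract"
  assumes "x \<in> ratfuns_over (constants UNIV)"
  shows "der x = 0"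
proof -
  have "der p = 0" if "p \<in> polys_over (constants UNIV)" for p :: "'a poly"
    using that by (intro poly_eqI) (auto simp: coeff_der_poly polys_over_def constants_def)
  with assms show ?thesis
    by (auto simp: ratfuns_over_def der_Fract Zero_fract_def eq_fract)
qed


section \<open>Right factors of order one\<close>

text \<open>The remainder of an operator \<open>p\<close> under right division by \<open>\<partial> - \<phi>\<close>: if \<open>y' = \<phi> y\<close>, then
  \<open>p(y) = riccati_remainder \<phi> p \<cdot> y\<close>.\<close>

definition riccati_remainder :: "'a::differential_ring \<Rightarrow> 'a poly \<Rightarrow> 'a" where
  "riccati_remainder \<phi> p = (\<Sum>i\<le>degree p. coeff p i * ((\<lambda>y. der y + \<phi> * y) ^^ i) 1)"

lemma riccati_remainder_bound:
  assumes "degree p \<le> n"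
  shows "riccati_remainder \<phi> p = (\<Sum>i\<le>n. coeff p i * ((\<lambda>y. der y + \<phi> * y) ^^ i) 1)"
  unfolding riccati_remainder_def
  by (rule sum.mono_neutral_left) (use assms in \<open>auto simp: coeff_eq_0\<close>)

lemma riccati_remainder_add:
  "riccati_remainder \<phi> (p + q) = riccati_remainder \<phi> p + riccati_remainder \<phi> q"
proof -
  define n where "n = max (degree p) (degree q)"
  have "degree (p + q) \<le> n" "degree p \<le> n" "degree q \<le> n"
    by (auto simp: n_def degree_add_le_max)
  then show ?thesis
    by (simp add: riccati_remainder_bound[of _ n] algebra_simps sum.distrib)
qed

lemma riccati_remainder_smult: "riccati_remainder \<phi> (smult a p) = a * riccati_remainder \<phi> p"
  by (subst riccati_remainder_bound[OF degree_smult_le])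
    (simp add: riccati_remainder_def sum_distrib_left mult.assoc)

text \<open>With \<open>r\<close> the remainder of \<open>p\<close> and \<open>y' = \<phi> y\<close>, this is \<open>\<partial>(r y) = (r' + \<phi> r) y\<close>.  It makes
  the remainders of all left multiples of an operator vanish with its own remainder.\<close>

lemma riccati_remainder_dleft:
  "riccati_remainder \<phi> (dleft p) = der (riccati_remainder \<phi> p) + \<phi> * riccati_remainder \<phi> p"
proof -
  define y where "y i = ((\<lambda>y. der y + \<phi> * y) ^^ i) 1" for i
  have y: "y (Suc i) = der (y i) + \<phi> * y i" for i
    by (simp add: y_def)
  have "riccati_remainder \<phi> (der p) = (\<Sum>i\<le>degree p. der (coeff p i) * y i)"
    using degree_der_le[of p] by (simp add: riccati_remainder_bound[of _ "degree p"] y_def coeff_der_poly)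
  moreover have "riccati_remainder \<phi> (pCons 0 p) = (\<Sum>i\<le>degree p. coeff p i * y (Suc i))"
    by (subst riccati_remainder_bound[OF degree_pCons_le], subst sum.atMost_Suc_shift)
      (simp add: y_def)
  moreover have "riccati_remainder \<phi> p = (\<Sum>i\<le>degree p. coeff p i * y i)"
    by (simp add: riccati_remainder_def y_def)
  ultimately show ?thesis
    by (simp add: dleft_def riccati_remainder_add der_sum der_mult y sum_distrib_left
        algebra_simps flip: sum.distrib)
qed

lemma riccati_remainder_dmult:
  assumes "riccati_remainder \<phi> g = 0"
  shows "riccati_remainder \<phi> (dmult q g) = 0"
  using assms
proof (induction q arbitrary: g)
  case 0
  then show ?case by (simp add: riccati_remainder_def)
next
  case (pCons a q)
  have "riccati_remainder \<phi> (dleft g) = 0"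
    using pCons.prems by (simp add: riccati_remainder_dleft)
  then show ?case
    by (simp add: dmult_pCons riccati_remainder_add riccati_remainder_smult pCons.IH pCons.prems)
qed

lemma first_order_symb: "symb (op_D - op_const \<phi>) = [:- \<phi>, 1:]"
  for \<phi> :: "'a::differential_ring"
  by transfer simp

lemma schroedinger_symb: "symb (schroedinger u) = [:u, 0, - 1:]"
  unfolding schroedinger_def
  by transfer (simp add: dmult_pCons dleft_def der_pCons)

text \<open>For \<open>-\<partial>\<^sup>2 + v - x\<close> the remainder is \<open>-(\<phi>' + \<phi>\<^sup>2) + v - x\<close>.\<close>

lemma riccati_if_right_divides:
  fixes \<phi> x v :: "'a::differential_field"
  assumes "right_divides (op_D - op_const \<phi>) M" and M: "symb M = [:v - x, 0, - 1:]"
  shows "der \<phi> + \<phi>\<^sup>2 = v - x"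
proof -
  obtain Q where "M = Q * (op_D - op_const \<phi>)"
    using assms by (auto simp: right_divides_def)
  then have "symb M = dmult (symb Q) [:- \<phi>, 1:]"
    by (simp add: times_diffop.rep_eq first_order_symb)
  moreover have "riccati_remainder \<phi> [:- \<phi>, 1:] = 0"
    by (simp add: riccati_remainder_def)
  ultimately have "riccati_remainder \<phi> (symb M) = 0"
    by (simp add: riccati_remainder_dmult)
  then show ?thesis
    by (simp add: M riccati_remainder_def power2_eq_square algebra_simps numeral_2_eq_2)
qed

lemma first_order_solution:
  fixes y :: "'a::differential_field"
  assumes "op_apply (op_D - op_const \<phi>) y = 0"
  shows "der y = \<phi> * y"
proof -
  have "op_coeff (op_D - op_const \<phi>) = coeff [:- \<phi>, 1:]" "op_order (op_D - op_const \<phi>) = 1"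
    by (simp_all add: op_coeff.rep_eq op_order.rep_eq first_order_symb)
  with assms show ?thesis
    by (simp add: op_apply_def algebra_simps)
qed


section \<open>Adjoining an exponential\<close>

text \<open>The condition under which an exponential \<open>y' = \<phi> y\<close> is independent of \<open>F\<close>: a nonzero \<open>a\<close>
  excluded here would make \<open>y\<^sup>n / a\<close> a constant.\<close>

definition log_free :: "'a::differential_field set \<Rightarrow> 'a \<Rightarrow> bool" where
  "log_free F \<phi> \<longleftrightarrow> (\<forall>n>0. \<forall>a\<in>F. der a = of_nat n * \<phi> * a \<longrightarrow> a = 0)"

text \<open>The derivation of \<open>F[X]\<close> that extends the one of \<open>F\<close> by \<open>X' = \<phi> X\<close>.\<close>

definition exp_der :: "'a::differential_field \<Rightarrow> 'a poly \<Rightarrow> 'a poly" where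
  "exp_der \<phi> p = der p + smult \<phi> (pCons 0 (pderiv p))"

lemma der_poly_value:
  fixes p :: "'a::differential_field poly"
  shows "der (poly p y) = poly (der p) y + der y * poly (pderiv p) y"
  by (induction p) (simp_all add: der_add der_mult der_pCons pderiv_pCons algebra_simps)

lemma der_poly_exponential:
  fixes p :: "'a::differential_field poly"
  assumes "der y = \<phi> * y"
  shows "der (poly p y) = poly (exp_der \<phi> p) y"
  by (simp add: der_poly_value assms exp_der_def algebra_simps)

lemma coeff_exp_der: "coeff (exp_der \<phi> p) i = der (coeff p i) + of_nat i * \<phi> * coeff p i"
  by (cases i) (simp_all add: exp_der_def coeff_der_poly coeff_pderiv algebra_simps)

lemma subfieldD:
  assumes "is_subfield S"
  shows "0 \<in> S" "1 \<in> S" "x \<in> S \<Longrightarrow> y \<in> S \<Longrightarrow> x + y \<in> S" "x \<in> S \<Longrightarrow> y \<in> S \<Longrightarrow> x - y \<in> S"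
    "x \<in> S \<Longrightarrow> y \<in> S \<Longrightarrow> x * y \<in> S" "x \<in> S \<Longrightarrow> inverse x \<in> S" "x \<in> S \<Longrightarrow> y \<in> S \<Longrightarrow> x / y \<in> S"
  using assms unfolding is_subfield_def divide_inverse by blast+

lemma subfield_of_nat: "is_subfield S \<Longrightarrow> of_nat n \<in> S"
  by (induction n) (auto intro: subfieldD)

lemma subfield_sum: "is_subfield S \<Longrightarrow> (\<And>i. i \<in> I \<Longrightarrow> f i \<in> S) \<Longrightarrow> sum f I \<in> S"
  by (induction I rule: infinite_finite_induct) (auto intro: subfieldD)

lemma polys_over_closed:
  assumes S: "is_subfield S"
  shows "0 \<in> polys_over S" "1 \<in> polys_over S"
    "p \<in> polys_over S \<Longrightarrow> q \<in> polys_over S \<Longrightarrow> p + q \<in> polys_over S"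
    "p \<in> polys_over S \<Longrightarrow> q \<in> polys_over S \<Longrightarrow> p - q \<in> polys_over S"
    "p \<in> polys_over S \<Longrightarrow> q \<in> polys_over S \<Longrightarrow> p * q \<in> polys_over S"
    "a \<in> S \<Longrightarrow> p \<in> polys_over S \<Longrightarrow> smult a p \<in> polys_over S"
    "a \<in> S \<Longrightarrow> p \<in> polys_over S \<Longrightarrow> pCons a p \<in> polys_over S"
  using subfieldD[OF S]
  by (auto simp: polys_over_def coeff_mult coeff_pCons coeff_1 intro!: subfield_sum[OF S]
      split: nat.split)

lemma exp_der_in_polys_over:
  assumes F: "is_diff_subfield F" and "\<phi> \<in> F" "p \<in> polys_over F"
  shows "exp_der \<phi> p \<in> polys_over F"
proof -
  have "is_subfield F" "\<And>x. x \<in> F \<Longrightarrow> der x \<in> F"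
    using F by (auto simp: is_diff_subfield_def)
  with assms subfieldD[of F] subfield_of_nat[of F] show ?thesis
    by (auto simp: polys_over_def coeff_exp_der)
qed

text \<open>Compare coefficients: \<open>p\<^sub>i' = (d - i) \<phi> p\<^sub>i\<close>.  For \<open>i < d\<close> a nonzero \<open>p\<^sub>i\<close> contradicts
  \<open>log_free\<close>, and for \<open>i > d\<close> its inverse does.\<close>

lemma eigenvector_monomial:
  assumes F: "is_diff_subfield F" and free: "log_free F \<phi>" and p: "p \<in> polys_over F"
    and eigen: "exp_der \<phi> p = smult (of_nat d * \<phi>) p"
  shows "p = monom (coeff p d) d"
proof -
  have S: "is_subfield F"
    using F by (auto simp: is_diff_subfield_def)
  have "coeff p i = 0" if "i \<noteq> d" for i
  proof (rule ccontr)
    assume nz: "coeff p i \<noteq> 0"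
    have mem: "coeff p i \<in> F" "inverse (coeff p i) \<in> F"
      using p subfieldD(6)[OF S] by (auto simp: polys_over_def)
    have eq: "der (coeff p i) + of_nat i * \<phi> * coeff p i = of_nat d * \<phi> * coeff p i"
      using arg_cong[OF eigen, of "\<lambda>q. coeff q i"] by (simp add: coeff_exp_der)
    show False
    proof (cases "i < d")
      case True
      then have "der (coeff p i) = of_nat (d - i) * \<phi> * coeff p i"
        using eq by (simp add: of_nat_diff algebra_simps)
      then show False
        using free True mem nz unfolding log_free_def by (meson zero_less_diff)
    next
      case False
      then have less: "d < i" using that by simp
      have "der (coeff p i * inverse (coeff p i)) = 0"
        using nz by simp
      then have "coeff p i * der (inverse (coeff p i)) = - (der (coeff p i) * inverse (coeff p i))"
        unfolding der_mult by (simp add: eq_neg_iff_add_eq_0 add.commute)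
      then have "inverse (coeff p i) * (coeff p i * der (inverse (coeff p i)))
          = inverse (coeff p i) * - (der (coeff p i) * inverse (coeff p i))"
        by simp
      then have "der (inverse (coeff p i)) = - der (coeff p i) * inverse (coeff p i) * inverse (coeff p i)"
        using nz by (simp add: mult.assoc[symmetric])
      also have "der (coeff p i) = - (of_nat (i - d) * \<phi> * coeff p i)"
        using eq less by (simp add: of_nat_diff algebra_simps)
      finally have "der (inverse (coeff p i)) = of_nat (i - d) * \<phi> * inverse (coeff p i)"
        using nz by simp
      then show False
        using free less mem nz unfolding log_free_def by (metis inverse_zero_imp_zero zero_less_diff)
    qed
  qed
  then show ?thesis
    by (intro poly_eqI) auto
qed

text \<open>The leading term \<open>X\<^sup>d\<close> is itself an eigenvector, so it cancels.\<close>

lemma degree_eigen_defect: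
  assumes "lead_coeff q = 1" "exp_der \<phi> q \<noteq> smult (of_nat (degree q) * \<phi>) q"
  shows "degree (exp_der \<phi> q - smult (of_nat (degree q) * \<phi>) q) < degree q"
proof -
  let ?r = "exp_der \<phi> q - smult (of_nat (degree q) * \<phi>) q"
  have "coeff ?r i = 0" if "degree q \<le> i" for i
    using that assms(1) by (cases "i = degree q") (auto simp: coeff_exp_der coeff_eq_0)
  then have "degree ?r < degree q \<or> ?r = 0"
    by (metis leading_coeff_0_iff not_le)
  then show ?thesis
    using assms by auto
qed

lemma minimal_monic:
  assumes S: "is_subfield F" and q: "q \<in> polys_over F" "q \<noteq> 0" "Q q"
    and scale: "\<And>a q. a \<in> F \<Longrightarrow> a \<noteq> 0 \<Longrightarrow> Q q \<Longrightarrow> Q (smult a q)"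
  obtains q where "q \<in> polys_over F" "lead_coeff q = 1" "Q q"
    "\<And>r. r \<in> polys_over F \<Longrightarrow> r \<noteq> 0 \<Longrightarrow> Q r \<Longrightarrow> degree q \<le> degree r"
proof -
  obtain q0 where 0: "q0 \<in> polys_over F" "q0 \<noteq> 0" "Q q0"
    and min: "\<And>r. r \<in> polys_over F \<Longrightarrow> r \<noteq> 0 \<Longrightarrow> Q r \<Longrightarrow> degree q0 \<le> degree r"
    using ex_has_least_nat[of "\<lambda>q. q \<in> polys_over F \<and> q \<noteq> 0 \<and> Q q" q degree] q by blast
  define a where "a = inverse (lead_coeff q0)"
  have a: "a \<in> F" "a \<noteq> 0"
    using 0 subfieldD(6)[OF S] by (auto simp: a_def polys_over_def)
  have "degree (smult a q0) = degree q0" "lead_coeff (smult a q0) = 1"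
    using 0 a by (simp_all add: a_def)
  then show thesis
    using that[of "smult a q0"] polys_over_closed(6)[OF S] a 0 scale min by metis
qed

lemma exponential_transcendental:
  assumes F: "is_diff_subfield F" and "\<phi> \<in> F" and free: "log_free F \<phi>"
    and y: "der y = \<phi> * y" "y \<noteq> 0"
  shows "\<not> algebraic_over F y"
proof
  assume "algebraic_over F y"
  then obtain p where p: "p \<in> polys_over F" "p \<noteq> 0" "poly p y = 0"
    by (auto simp: algebraic_over_def)
  have S: "is_subfield F"
    using F by (simp add: is_diff_subfield_def)
  obtain q where q: "q \<in> polys_over F" "lead_coeff q = 1" "poly q y = 0"
    and min: "\<And>r. r \<in> polys_over F \<Longrightarrow> r \<noteq> 0 \<Longrightarrow> poly r y = 0 \<Longrightarrow> degree q \<le> degree r"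
    by (rule minimal_monic[where Q = "\<lambda>q. poly q y = 0", OF S p]) auto
  define r where "r = exp_der \<phi> q - smult (of_nat (degree q) * \<phi>) q"
  have "poly (exp_der \<phi> q) y = 0"
    using der_poly_exponential[OF y(1), of q] q by simp
  then have "poly r y = 0"
    using q by (simp add: r_def)
  moreover have "r \<in> polys_over F"
    unfolding r_def using F S q assms(2)
    by (intro polys_over_closed exp_der_in_polys_over subfieldD subfield_of_nat)
  ultimately have "r = 0 \<or> degree q \<le> degree r"
    using min by blast
  then have "exp_der \<phi> q = smult (of_nat (degree q) * \<phi>) q"
    using degree_eigen_defect[OF q(2), of \<phi>] unfolding r_def
    by (metis eq_iff_diff_eq_0 not_le)
  from eigenvector_monomial[OF F free q(1) this] q(2) have "q = monom 1 (degree q)"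
    by simp
  then have "poly q y = y ^ degree q"
    by (metis poly_monom mult_1)
  with q y show False by simp
qed

text \<open>The polynomials \<open>q\<close> with \<open>c q(y) = p(y)\<close> for some \<open>p\<close> over \<open>F\<close> are the possible
  denominators of \<open>c\<close>.  As \<open>c\<close> is constant, the equation can be differentiated on both sides, and
  \<open>d \<phi>\<close> times the equation subtracted, without changing its form; by minimality the new
  denominator vanishes, and then the new numerator does by transcendence.  This leaves
  \<open>c y\<^sup>d = p\<^sub>d y\<^sup>d\<close>.\<close>

lemma exponential_constants:
  assumes F: "is_diff_subfield F" and "\<phi> \<in> F" and free: "log_free F \<phi>"
    and y: "der y = \<phi> * y" "y \<noteq> 0"
    and c: "c = poly p y / poly q y" "p \<in> polys_over F" "q \<in> polys_over F" "q \<noteq> 0" "der c = 0"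
  shows "c \<in> F"
proof -
  have S: "is_subfield F"
    using F by (simp add: is_diff_subfield_def)
  have inj: "p = 0" if "p \<in> polys_over F" "poly p y = 0" for p
    using exponential_transcendental[OF F assms(2) free y] that by (auto simp: algebraic_over_def)
  define Q where "Q q \<longleftrightarrow> (\<exists>p\<in>polys_over F. c * poly q y = poly p y)" for q
  have "poly q y \<noteq> 0"
    using inj c by blast
  then have "Q q"
    using c by (auto simp: Q_def)
  have scale: "Q (smult a q)" if "a \<in> F" "Q q" for a q
    using that polys_over_closed(6)[OF S, of a] unfolding Q_def
    by (metis poly_smult mult.left_commute)
  obtain q where q: "q \<in> polys_over F" "lead_coeff q = 1" "Q q"
    and min: "\<And>r. r \<in> polys_over F \<Longrightarrow> r \<noteq> 0 \<Longrightarrow> Q r \<Longrightarrow> degree q \<le> degree r"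
    by (rule minimal_monic[where Q = Q, OF S c(3,4) \<open>Q q\<close> scale]) auto
  obtain p where p: "p \<in> polys_over F" "c * poly q y = poly p y"
    using q(3) by (auto simp: Q_def)
  define d where "d = degree q"
  define D where "D r = exp_der \<phi> r - smult (of_nat d * \<phi>) r" for r
  have D: "D r \<in> polys_over F" if "r \<in> polys_over F" for r
    unfolding D_def using F S that assms(2)
    by (intro polys_over_closed exp_der_in_polys_over subfieldD subfield_of_nat)
  have "der (c * poly q y) = c * poly (exp_der \<phi> q) y"
    using c(5) by (simp add: der_mult der_poly_exponential[OF y(1)])
  then have "c * poly (exp_der \<phi> q) y = poly (exp_der \<phi> p) y"
    by (simp add: p der_poly_exponential[OF y(1)])
  then have rel: "c * poly (D q) y = poly (D p) y"
    using p(2) by (simp add: D_def algebra_simps)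
  then have "Q (D q)"
    using D p by (auto simp: Q_def)
  then have "D q = 0"
    using min[OF D[OF q(1)]] degree_eigen_defect[OF q(2), of \<phi>] unfolding D_def d_def
    by (metis eq_iff_diff_eq_0 not_le)
  moreover from this have "D p = 0"
    using inj[OF D[OF p(1)]] rel by simp
  ultimately have "q = monom (coeff q d) d" "p = monom (coeff p d) d"
    by (auto intro!: eigenvector_monomial[OF F free] p q simp: D_def)
  then have "poly q y = y ^ d" "poly p y = coeff p d * y ^ d"
    using q(2) by (metis d_def poly_monom mult_1)+
  then have "c = coeff p d"
    using p(2) y(2) by simp
  then show ?thesis
    using p(1) by (simp add: polys_over_def)
qed

lemma subfield_hull_insert:
  assumes S: "is_subfield F" and x: "x \<in> is_subfield hull (insert y F)"
  shows "\<exists>p\<in>polys_over F. \<exists>q\<in>polys_over F. poly q y \<noteq> 0 \<and> x = poly p y / poly q y"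
proof -
  define T where "T = {poly p y / poly q y | p q. p \<in> polys_over F \<and> q \<in> polys_over F \<and> poly q y \<noteq> 0}"
  note cl = polys_over_closed[OF S]
  have mem: "poly p y / poly q y \<in> T" if "p \<in> polys_over F" "q \<in> polys_over F" "poly q y \<noteq> 0" for p q
    using that by (auto simp: T_def)
  have "is_subfield T"
    unfolding is_subfield_def
  proof (intro conjI ballI)
    show "0 \<in> T" "1 \<in> T"
      using mem[of 0 1] mem[of 1 1] cl by simp_all
  next
    fix x z assume "x \<in> T" "z \<in> T"
    then obtain p q r s where *: "x = poly p y / poly q y" "z = poly r y / poly s y"
      "p \<in> polys_over F" "q \<in> polys_over F" "r \<in> polys_over F" "s \<in> polys_over F"
      "poly q y \<noteq> 0" "poly s y \<noteq> 0"
      unfolding T_def by blast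
    then have "x + z = poly (p * s + r * q) y / poly (q * s) y"
      "x - z = poly (p * s - r * q) y / poly (q * s) y" "x * z = poly (p * r) y / poly (q * s) y"
        by (simp_all add: add_frac_eq diff_frac_eq)
    moreover have "p * s + r * q \<in> polys_over F" "p * s - r * q \<in> polys_over F"
      "p * r \<in> polys_over F" "q * s \<in> polys_over F" "poly (q * s) y \<noteq> 0"
      using * cl by simp_all
    ultimately show "x + z \<in> T" "x - z \<in> T" "x * z \<in> T"
      by (simp_all only: mem simp_thms)
  next
    fix x assume "x \<in> T"
    then obtain p q where *: "x = poly p y / poly q y" "p \<in> polys_over F" "q \<in> polys_over F"
      "poly q y \<noteq> 0"
      unfolding T_def by blast
    show "inverse x \<in> T"
    proof (cases "poly p y = 0")
      case True
      then show ?thesis using mem[of 0 1] cl * by simp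
    next
      case False
      then show ?thesis using mem[of q p] * by simp
    qed
  qed
  moreover have "insert y F \<subseteq> T"
  proof -
    have "y \<in> T"
      using mem[of "[:0, 1:]" 1] cl subfieldD[OF S] by simp
    moreover have "a \<in> T" if "a \<in> F" for a
      using mem[of "[:a:]" 1] cl that by simp
    ultimately show ?thesis by auto
  qed
  ultimately have "is_subfield hull (insert y F) \<subseteq> T"
    by (intro hull_minimal)
  with x show ?thesis
    unfolding T_def by blast
qed

lemma is_subfield_hull: "is_subfield (is_subfield hull S)"
proof (rule hull_in)
  show "is_subfield (\<Inter>\<T>)" if "\<forall>S\<in>\<T>. is_subfield S" for \<T> :: "'a set set"
    using that by (simp add: is_subfield_def)
qed

lemma subfield_value:
  assumes S: "is_subfield S" and "p \<in> polys_over S" "y \<in> S"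
  shows "poly p y \<in> S"
proof -
  have "y ^ i \<in> S" for i
    by (induction i) (use assms subfieldD[OF S] in auto)
  then show ?thesis
    unfolding poly_altdef using assms subfieldD[OF S]
    by (intro subfield_sum) (auto simp: polys_over_def)
qed

text \<open>An exponential generates the same field with or without derivatives, so its adjunction is a
  single Liouvillian step.\<close>

lemma exponential_hull:
  assumes F: "is_diff_subfield F" and "\<phi> \<in> F" and y: "der y = \<phi> * y"
  shows "is_diff_subfield hull (F \<union> {y}) = is_subfield hull (insert y F)"
proof -
  define T where "T = is_subfield hull (insert y F)"
  have S: "is_subfield F"
    using F by (simp add: is_diff_subfield_def)
  have T: "is_subfield T" "insert y F \<subseteq> T"
    by (simp_all add: T_def is_subfield_hull hull_subset)
  have val: "poly p y \<in> T" if "p \<in> polys_over F" for p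
    using that T by (intro subfield_value) (auto simp: polys_over_def)
  have "der x \<in> T" if x: "x \<in> T" for x
  proof -
    obtain p q where *: "p \<in> polys_over F" "q \<in> polys_over F" "poly q y \<noteq> 0" "x = poly p y / poly q y"
      using subfield_hull_insert[OF S x[unfolded T_def]] by blast
    have "der (x * poly q y) = poly (exp_der \<phi> p) y"
      using * by (simp add: der_poly_exponential[OF y])
    then have "der x * poly q y + x * poly (exp_der \<phi> q) y = poly (exp_der \<phi> p) y"
      by (simp only: der_mult der_poly_exponential[OF y])
    then have "der x = (poly (exp_der \<phi> p) y - x * poly (exp_der \<phi> q) y) / poly q y"
      using *(3) by (simp add: eq_divide_eq eq_diff_eq)
    also have "\<dots> \<in> T"
      using * x val exp_der_in_polys_over[OF F assms(2)]
      by (intro subfieldD[OF T(1)]) auto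
    finally show ?thesis .
  qed
  then have "is_diff_subfield T"
    using T by (simp add: is_diff_subfield_def)
  then have "is_diff_subfield hull (F \<union> {y}) = T"
  proof (intro hull_unique)
    show "T \<subseteq> T'" if "F \<union> {y} \<subseteq> T'" "is_diff_subfield T'" for T'
      unfolding T_def using that by (intro hull_minimal) (auto simp: is_diff_subfield_def)
  qed (use T in auto)
  then show ?thesis
    by (simp add: T_def)
qed


section \<open>The solution of the intrinsic right factor\<close>

lemma diff_homD:
  assumes "diff_hom_on UNIV h"
  shows "h 0 = 0" "h 1 = 1" "h (x + y) = h x + h y" "h (x - y) = h x - h y" "h (x * y) = h x * h y"
    "h (x\<^sup>2) = (h x)\<^sup>2" "h (of_nat n) = of_nat n" "h (der x) = der (h x)" "inj h"
proof -
  show a: "h 1 = 1" "h (x + y) = h x + h y" "h (x * y) = h x * h y" "h (der x) = der (h x)" for x y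
    using assms by (auto simp: diff_hom_on_def)
  show z: "h 0 = 0"
    using a(2)[of 0 0] by (metis add_0 add_cancel_right_right)
  show d: "h (x - y) = h x - h y" for x y
    using a(2)[of "x - y" y] by (simp add: algebra_simps)
  show "h (x\<^sup>2) = (h x)\<^sup>2"
    by (simp add: power2_eq_square a)
  show "h (of_nat n) = of_nat n"
    by (induction n) (auto simp: a z)
  show "inj h"
  proof (rule injI)
    fix x y assume "h x = h y"
    then have "h (x - y) = 0" by (simp add: d)
    then show "x = y"
      using a(3)[of "x - y" "inverse (x - y)"] a(1) by (cases "x - y = 0") auto
  qed
qed

text \<open>In \<open>K[\<lambda>, \<mu>]\<close> every nonzero multiple of \<open>\<mu>\<^sup>2 + R(\<lambda>)\<close> has degree at least two in \<open>\<mu>\<close>, whereas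
  \<open>\<lambda> - a\<close> has degree zero.\<close>

lemma function_field_lam_nonconstant:
  assumes ff: "function_field K (spectral_poly \<iota> R) \<pi>" and S: "is_subfield K" and "a \<in> K"
  shows "\<pi> var_lam \<noteq> \<pi> [:[:a:]:]"
proof
  assume eq: "\<pi> var_lam = \<pi> [:[:a:]:]"
  have mem: "[:p:] \<in> polys_over (polys_over K)" if "p \<in> polys_over K" for p
    using that polys_over_closed(1)[OF S] by (auto simp: polys_over_def coeff_pCons split: nat.split)
  have K: "[:a:] \<in> polys_over K" "[:0, 1:] \<in> polys_over K" "[:- a, 1:] \<in> polys_over K"
    using assms(3) subfieldD[OF S] subfieldD(4)[OF S, of 0 a]
    by (auto intro!: polys_over_closed[OF S])
  have "[:[:0, 1:]:] = [:[:a:]:] + [:[:- a, 1:]:]"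
    by simp
  then have "\<pi> [:[:0, 1:]:] = \<pi> [:[:a:]:] + \<pi> [:[:- a, 1:]:]"
    using ff mem K unfolding function_field_def by metis
  then have "\<pi> [:[:- a, 1:]:] = 0"
    using eq by (simp add: var_lam_def)
  then obtain q where q: "[:[:- a, 1:]:] = spectral_poly \<iota> R * q"
    using ff mem K unfolding function_field_def by blast
  then have "q \<noteq> 0" by auto
  have f: "spectral_poly \<iota> R = [:map_poly \<iota> R, 0, 1:]"
    by (simp add: spectral_poly_def var_mu_def power2_eq_square)
  have "degree (spectral_poly \<iota> R * q) = 2 + degree q"
    using \<open>q \<noteq> 0\<close> by (subst degree_mult_eq) (auto simp: f)
  then show False
    using arg_cong[OF q, of degree] by simp
qed

text \<open>The pole of the nonconstant \<open>\<chi>\<close> forces a pole of \<open>\<phi>\<close> at the same point, where logarithmic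
  derivatives are regular.  Multiplication by \<open>n\<close> preserves the pole since \<open>\<iota>\<close> makes the
  characteristic zero.\<close>

lemma log_free_intrinsic_factor:
  fixes \<iota> :: "complex \<Rightarrow> 'a::differential_field"
  assumes \<iota>: "constant_field_embedding \<iota>"
    and nonconstant: "\<And>c. ratfun_map \<iota> \<chi> \<noteq> Fract [:\<iota> c:] 1"
    and riccati: "der \<phi> + \<phi>\<^sup>2 = Fract [:v:] 1 - ratfun_map \<iota> \<chi>"
  shows "log_free UNIV \<phi>"
  unfolding log_free_def
proof (intro allI impI ballI, rule ccontr)
  fix n :: nat and b
  assume n: "n > 0" and b: "der b = of_nat n * \<phi> * b" "b \<noteq> 0"
  have "of_nat n \<noteq> (0::'a)"
    using n constant_embedding_hom(5,6)[OF \<iota>] by (metis of_nat_eq_0_iff not_less0)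
  then have "ratfun_map \<iota> \<chi> \<in> V" if "log_closed_ring V" for V
    using riccati_potential_regular[OF that b(2,1) _ riccati] by blast
  then show False
    using everywhere_regular_imp_constant[OF \<iota>] nonconstant log_closed_regular_at_infinity
      log_closed_regular_at constant_embedding_hom(7)[OF \<iota>] by metis
qed

theorem theorem6p3:
  fixes \<iota> :: "complex \<Rightarrow> 'a::differential_field"
    and u :: 'a
    and s :: nat
    and A :: "'a diffop"
    and R :: "complex poly"
    and K :: "'a set"
    and \<pi> :: "'a poly poly \<Rightarrow> 'g::differential_field"
    and \<phi> :: 'g
    and \<chi>1 \<chi>2 :: "complex poly fract"
    and \<rho> :: "'g \<Rightarrow> 'a poly fract"
    and j :: "'a poly fract \<Rightarrow> 'c::differential_field"
    and \<Upsilon> :: 'c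
  assumes constants: "constant_field_embedding \<iota>"
    and u: "u \<notin> range \<iota>"
    and algebro_geometric: "algebro_geometric \<iota> (schroedinger u)"
    and partner: "partner \<iota> s (schroedinger u) A R"
    and K: "K = is_diff_subfield hull (range \<iota> \<union> {u})"
    and K_Gamma: "function_field K (spectral_poly \<iota> R) \<pi>"
    and \<phi>: "monic_gcrd (op_D - op_const \<phi>)
           (op_map (coeff_embedding \<pi>) (schroedinger u) - op_const (\<pi> var_lam))
           (op_map (coeff_embedding \<pi>) A - op_const (\<pi> var_mu))"
    and rational: "rational_parametrization R \<chi>1 \<chi>2"
    and \<rho>: "parametrization_iso \<iota> K \<pi> \<chi>1 \<chi>2 \<rho>"
    and j: "diff_hom_on (ratfuns_over K) j"
    and closure: "differential_closure_of (j ` ratfuns_over K)"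
    and \<Upsilon>: "\<Upsilon> \<noteq> 0" "op_apply (op_D - op_const (j (\<rho> \<phi>))) \<Upsilon> = 0"
    and E: "E = is_diff_subfield hull (j ` ratfuns_over K \<union> {\<Upsilon>})"
  shows "liouvillian_extension (j ` ratfuns_over K) E \<and>
         transcendental_extension (j ` ratfuns_over K) E \<and>
         constants E = j ` ratfuns_over (range \<iota>)"
proof -
  define F where "F = j ` ratfuns_over K"
  \<comment> \<open>Viewing \<open>F\<close> as the image of the field \<open>K(\<Gamma>)\<close> makes \<open>h\<close> a homomorphism on a whole type, hence
    injective, and lets differential equations pass from \<open>F\<close> to \<open>K(\<tau>)\<close> through \<open>K(\<Gamma>)\<close>.\<close>
  define h where "h = j \<circ> \<rho>"
  have \<rho>_hom: "diff_hom_on UNIV \<rho>" and \<rho>_bij: "bij_betw \<rho> UNIV (ratfuns_over K)"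
    and \<rho>_K: "\<And>a. a \<in> K \<Longrightarrow> \<rho> (\<pi> [:[:a:]:]) = Fract [:a:] 1"
    and \<rho>_lam: "\<rho> (\<pi> var_lam) = ratfun_map \<iota> \<chi>1"
    using \<rho> by (auto simp: parametrization_iso_def)
  have range_\<rho>: "range \<rho> = ratfuns_over K"
    using \<rho>_bij by (simp add: bij_betw_def)
  have h_hom: "diff_hom_on UNIV h"
    using \<rho>_hom j range_\<rho> by (fastforce simp: diff_hom_on_def h_def)
  have range_h: "range h = F"
    by (simp add: h_def F_def image_comp flip: range_\<rho>)
  have F: "is_diff_subfield F"
    using closure by (simp add: F_def differential_closure_of_def)
  have range_eq: "range \<iota> = constants UNIV"
    using constants by (simp add: constant_field_embedding_def)
  have "is_diff_subfield K"
    unfolding K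
  proof (rule hull_in)
    show "is_diff_subfield (\<Inter>\<T>)" if "\<forall>S\<in>\<T>. is_diff_subfield S" for \<T> :: "'a set set"
      using that by (simp add: is_diff_subfield_def is_subfield_def)
  qed
  then have K_sub: "is_subfield K"
    by (simp add: is_diff_subfield_def)
  have "range \<iota> \<union> {u} \<subseteq> K"
    unfolding K by (rule hull_subset)
  then have \<iota>_K: "\<iota> c \<in> K" and u_K: "u \<in> K" for c
    by auto

  have \<pi>_0: "\<pi> 0 = 0" and \<pi>_1: "\<pi> 1 = 1" and \<pi>_neg: "\<pi> [:[:- 1:]:] = - 1"
  proof -
    have mem: "[:[:a:]:] \<in> polys_over (polys_over K)" if "a \<in> K" for a
      using that subfieldD(1)[OF K_sub] by (auto simp: polys_over_def coeff_pCons split: nat.split)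
    have add: "\<pi> [:[:a + b:]:] = \<pi> [:[:a:]:] + \<pi> [:[:b:]:]" if "a \<in> K" "b \<in> K" for a b
    proof -
      have "[:[:a + b:]:] = [:[:a:]:] + [:[:b:]:]" by simp
      then show ?thesis
        using K_Gamma mem that unfolding function_field_def by metis
    qed
    note cl = subfieldD[OF K_sub]
    show 0: "\<pi> 0 = 0"
      using add[of 0 0] cl(1) by (metis add_0 add_cancel_right_right pCons_0_0)
    show 1: "\<pi> 1 = 1"
      using K_Gamma by (simp add: function_field_def)
    show "\<pi> [:[:- 1:]:] = - 1"
      using add[of 1 "- 1"] cl cl(4)[of 0 1] 0 1
      by (simp add: eq_neg_iff_add_eq_0 add.commute flip: one_pCons)
  qed
  have "symb (op_map (\<lambda>a. \<pi> [:[:a:]:]) (schroedinger u) - op_const (\<pi> var_lam))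
      = [:\<pi> [:[:u:]:] - \<pi> var_lam, 0, - 1:]"
    by (simp add: minus_diffop.rep_eq op_map.rep_eq op_const.rep_eq schroedinger_symb
        map_poly_pCons \<pi>_0 \<pi>_neg)
  with \<phi> have "der \<phi> + \<phi>\<^sup>2 = \<pi> [:[:u:]:] - \<pi> var_lam"
    unfolding monic_gcrd_def by (blast intro: riccati_if_right_divides)
  from arg_cong[OF this, of \<rho>]
  have riccati: "der (\<rho> \<phi>) + (\<rho> \<phi>)\<^sup>2 = Fract [:u:] 1 - ratfun_map \<iota> \<chi>1"
    by (simp add: diff_homD[OF \<rho>_hom] \<rho>_K u_K \<rho>_lam flip: diff_homD(8)[OF \<rho>_hom])
  have "ratfun_map \<iota> \<chi>1 \<noteq> Fract [:\<iota> c:] 1" for c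
    using function_field_lam_nonconstant[OF K_Gamma K_sub \<iota>_K, of c] \<rho>_K[OF \<iota>_K, of c] \<rho>_lam
      diff_homD(9)[OF \<rho>_hom] by (metis injD)
  then have free_\<rho>: "log_free UNIV (\<rho> \<phi>)"
    using log_free_intrinsic_factor[OF constants _ riccati] by blast

  have free: "log_free F (h \<phi>)"
    unfolding log_free_def
  proof (intro allI impI ballI)
    fix n :: nat and a
    assume n: "n > 0" and "a \<in> F" and a: "der a = of_nat n * h \<phi> * a"
    then obtain g where g: "a = h g"
      using range_h by blast
    have "h (der g) = h (of_nat n * \<phi> * g)"
      using a by (simp add: g diff_homD[OF h_hom])
    then have "der g = of_nat n * \<phi> * g"
      using diff_homD(9)[OF h_hom] by (simp add: inj_eq)
    then have "der (\<rho> g) = of_nat n * \<rho> \<phi> * \<rho> g"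
      by (simp add: diff_homD[OF \<rho>_hom] flip: diff_homD(8)[OF \<rho>_hom])
    then have "\<rho> g = 0"
      using free_\<rho> n by (auto simp: log_free_def)
    then have "g = 0"
      using diff_homD(1,9)[OF \<rho>_hom] by (metis injD)
    then show "a = 0"
      by (simp add: g diff_homD[OF h_hom])
  qed
  have y: "der \<Upsilon> = h \<phi> * \<Upsilon>"
    using first_order_solution[OF \<Upsilon>(2)] by (simp add: h_def)
  have \<phi>_F: "h \<phi> \<in> F"
    using range_h by blast
  have E_hull: "E = is_subfield hull (insert \<Upsilon> F)"
    unfolding E F_def[symmetric] by (rule exponential_hull[OF F \<phi>_F y])
  have FE: "insert \<Upsilon> F \<subseteq> E"
    unfolding E_hull by (rule hull_subset)

  have "liouvillian_extension F E"
    unfolding E_hull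
    by (rule liouvillian_extension.exponential[OF liouvillian_extension.refl])
      (use \<Upsilon>(1) \<phi>_F in \<open>simp_all add: y\<close>)
  moreover have "transcendental_extension F E"
    using exponential_transcendental[OF F \<phi>_F free y \<Upsilon>(1)] FE
    by (auto simp: transcendental_extension_def)
  moreover have "constants E = j ` ratfuns_over (range \<iota>)"
  proof (intro set_eqI iffI)
    fix c assume "c \<in> constants E"
    then have c: "c \<in> E" "der c = 0"
      by (auto simp: constants_def)
    have "is_subfield F"
      using F by (simp add: is_diff_subfield_def)
    then obtain p q where "p \<in> polys_over F" "q \<in> polys_over F" "poly q \<Upsilon> \<noteq> 0"
      "c = poly p \<Upsilon> / poly q \<Upsilon>"
      using subfield_hull_insert[OF _ c(1)[unfolded E_hull]] by blast
    moreover from this have "q \<noteq> 0" by auto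
    ultimately have "c \<in> F"
      using exponential_constants[OF F \<phi>_F free y \<Upsilon>(1)] c(2) by blast
    then obtain g where g: "c = h g"
      using range_h by blast
    then have "h (der g) = h 0"
      using c(2) by (simp add: diff_homD[OF h_hom])
    then have "der g = 0"
      using diff_homD(9)[OF h_hom] by (simp add: inj_eq)
    then have "der (\<rho> g) = 0"
      by (simp add: diff_homD(1)[OF \<rho>_hom] flip: diff_homD(8)[OF \<rho>_hom])
    then have "\<rho> g \<in> ratfuns_over (range \<iota>)"
      unfolding range_eq by (rule constant_ratfun)
    then show "c \<in> j ` ratfuns_over (range \<iota>)"
      by (auto simp: g h_def)
  next
    fix c assume "c \<in> j ` ratfuns_over (range \<iota>)"
    then obtain x where x: "c = j x" "x \<in> ratfuns_over (range \<iota>)"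
      by blast
    have "x \<in> ratfuns_over K"
    proof -
      have "range \<iota> \<subseteq> K" using \<iota>_K by blast
      then have "polys_over (range \<iota>) \<subseteq> polys_over K"
        by (auto simp: polys_over_def)
      with x(2) show ?thesis
        unfolding ratfuns_over_def by blast
    qed
    moreover from x(2) have "der x = 0"
      unfolding range_eq by (rule der_ratfun_over_constants)
    moreover obtain g where "x = \<rho> g"
      using \<open>x \<in> ratfuns_over K\<close> range_\<rho> by blast
    ultimately have "c = h g" "der (\<rho> g) = 0"
      by (simp_all add: x h_def)
    then have "der g = 0"
      using diff_homD(1,8,9)[OF \<rho>_hom] by (metis injD)
    then have "der c = 0"
      using \<open>c = h g\<close> diff_homD(1,8)[OF h_hom] by metis
    moreover have "c \<in> E"
      using \<open>c = h g\<close> range_h FE by blast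
    ultimately show "c \<in> constants E"
      by (simp add: constants_def)
  qed
  ultimately show ?thesis
    by (simp add: F_def)
qed

end
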